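(* Let $a,b$ be nonzero real numbers and let $j$ be a positive even integer. Then for every nonzero real $x$, \[ \sqrt[j]{\frac{\psi^{a,b}_{j}\!\left(\frac1a\left(x-\frac bx\right)\right)}{2}+\sqrt{\frac{\left(\psi^{a,b}_{j}\!\left(\frac1a\left(x-\frac bx\right)\right)\right)^2}{4}-b^j}}=\begin{cases}|x|,& x\in\mathbb{R}\setminus(-\sqrt{|b|},\sqrt{|b|}),\\ \left|\frac bx\right|,& x\in(-\sqrt{|b|},\sqrt{|b|}).\end{cases} \]
   Context: The generalized Lucas polynomials are defined by $\psi^{a,b}_0(x)=2$, $\psi^{a,b}_1(x)=ax$, $\psi^{a,b}_j(x)=ax\,\psi^{a,b}_{j-1}(x)+b\,\psi^{a,b}_{j-2}(x)$ for $j\ge2$. $\sqrt{\cdot}$ is the nonnegative square root and, for even $j$, $\sqrt[j]{\cdot}$ is the nonnegative $j$-th root of a nonnegative real. *)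

theory Defs
  imports Complex_Main
begin

fun gen_lucas :: "real \<Rightarrow> real \<Rightarrow> nat \<Rightarrow> real \<Rightarrow> real" where
  "gen_lucas a b 0 x = 2"
| "gen_lucas a b (Suc 0) x = a * x"
| "gen_lucas a b (Suc (Suc j)) x = a * x * gen_lucas a b (Suc j) x + b * gen_lucas a b j x"

end

theory Submission
  imports Defs
begin

text \<open>The argument of the polynomial is chosen so that z^2 = a t z + b has the roots x and
  -b/x. A Binet formula (\<open>gen_lucas_binet\<close>) and the evenness of j then give the value
  |x|^j + |b/x|^j. Since these two powers have product b^j, the expression under the j-th root is
  the quadratic formula for the larger of them (\<open>half_sum_plus_sqrt_eq_max\<close>). Its root
  is max(|x|, |b/x|), and \<open>sqrt_abs_le_abs_iff\<close> decides which one wins.\<close>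

text \<open>By Vieta, p and q are the roots of z^2 = a t z + b, so their power sums obey the
  recurrence and start with 2 and a t. The case p = q is covered too.\<close>

lemma gen_lucas_binet:
  assumes "a * t = p + q" and "p * q = - b"
  shows "gen_lucas a b j t = p ^ j + q ^ j"
proof (induction j rule: induct_nat_012)
  case (ge2 n)
  \<comment> \<open>On expanding, the cross terms p q^(n+1) and q p^(n+1) cancel against p q (p^n +
    q^n).\<close>
  have "gen_lucas a b (Suc (Suc n)) t = (p + q) * (p ^ Suc n + q ^ Suc n) - p * q * (p ^ n + q ^ n)"
    by (simp add: ge2 assms del: power_Suc)
  then show ?case
    by (simp add: algebra_simps)
qed (simp_all add: assms(1))

text \<open>The radicand is the perfect square ((u - v)/2)^2, and midpoint plus half the distance is
  the larger endpoint.\<close>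

lemma half_sum_plus_sqrt_eq_max:
  fixes u v :: real
  shows "(u + v) / 2 + sqrt ((u + v)\<^sup>2 / 4 - u * v) = max u v"
proof -
  have "(u + v)\<^sup>2 / 4 - u * v = ((u - v) / 2)\<^sup>2"
    by (simp add: power2_eq_square field_simps)
  then have "sqrt ((u + v)\<^sup>2 / 4 - u * v) = \<bar>(u - v) / 2\<bar>"
    by simp
  then show ?thesis
    by (simp add: max_def abs_if field_simps)
qed

lemma sqrt_abs_le_abs_iff:
  fixes b x :: real
  assumes "x \<noteq> 0"
  shows "sqrt \<bar>b\<bar> \<le> \<bar>x\<bar> \<longleftrightarrow> \<bar>b / x\<bar> \<le> \<bar>x\<bar>"
proof -
  have "sqrt \<bar>b\<bar> \<le> \<bar>x\<bar> \<longleftrightarrow> \<bar>b\<bar> \<le> \<bar>x\<bar>\<^sup>2"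
    by (metis abs_ge_zero real_sqrt_abs real_sqrt_le_iff abs_abs)
  also have "\<dots> \<longleftrightarrow> \<bar>b / x\<bar> \<le> \<bar>x\<bar>"
    using assms by (simp add: abs_divide pos_divide_le_eq power2_eq_square)
  finally show ?thesis .
qed

theorem theorem8:
  fixes a b x :: real and j :: nat
  assumes "a \<noteq> 0" and "b \<noteq> 0"
    and "0 < j" and "even j"
    and "x \<noteq> 0"
  shows "root j (gen_lucas a b j (1 / a * (x - b / x)) / 2
            + sqrt ((gen_lucas a b j (1 / a * (x - b / x)))\<^sup>2 / 4 - b ^ j))
         = (if x \<in> UNIV - {- sqrt \<bar>b\<bar> <..< sqrt \<bar>b\<bar>} then \<bar>x\<bar> else \<bar>b / x\<bar>)"
proof -
  define y where "y = b / x"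
  \<comment> \<open>Evenness of j absorbs the sign of the root -y and allows absolute values, so
    that later the j-th root is taken of powers of nonnegative numbers.\<close>
  have psi: "gen_lucas a b j (1 / a * (x - b / x)) = \<bar>x\<bar> ^ j + \<bar>y\<bar> ^ j"
    using gen_lucas_binet[of a "1 / a * (x - b / x)" x "- y" b j] assms
    by (simp add: y_def power_even_abs del: abs_divide)
  have "\<bar>x\<bar> ^ j * \<bar>y\<bar> ^ j = b ^ j"
    using assms by (simp add: y_def power_even_abs del: abs_divide flip: power_mult_distrib)
  then have "root j (gen_lucas a b j (1 / a * (x - b / x)) / 2
      + sqrt ((gen_lucas a b j (1 / a * (x - b / x)))\<^sup>2 / 4 - b ^ j))
      = root j (max (\<bar>x\<bar> ^ j) (\<bar>y\<bar> ^ j))"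
    using half_sum_plus_sqrt_eq_max[of "\<bar>x\<bar> ^ j" "\<bar>y\<bar> ^ j"] psi by simp
  also have "\<dots> = max \<bar>x\<bar> \<bar>y\<bar>"
    using \<open>0 < j\<close> by (simp add: max_def real_root_power_cancel)
  \<comment> \<open>In the tie |x| = |y| both branches agree, so the boundary may go to either
    case.\<close>
  also have "\<dots> = (if sqrt \<bar>b\<bar> \<le> \<bar>x\<bar> then \<bar>x\<bar> else \<bar>y\<bar>)"
    using sqrt_abs_le_abs_iff[OF \<open>x \<noteq> 0\<close>, of b] by (simp add: y_def max_def)
  also have "sqrt \<bar>b\<bar> \<le> \<bar>x\<bar> \<longleftrightarrow> x \<in> UNIV - {- sqrt \<bar>b\<bar> <..< sqrt \<bar>b\<bar>}"
    by auto
  finally show ?thesis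
    by (simp only: y_def)
qed

end
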